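(* Let $V\subset\mathbb{R}^n$ be a closed convex cone. If a pair $(A,B)\in\mathcal{C}_V^2(\mathbb{R}^n)$ has the property of translation, then every $0$-minimal pair $(C,D)\in[A,B]$ is reduced.
   Context: $\mathcal{C}_V(\mathbb{R}^n)$ is the family of all nonempty closed convex sets $A\subset\mathbb{R}^n$ whose recession cone $\{x\in\mathbb{R}^n \mid x+A\subset A\}$ equals $V$; $\mathcal{C}_V^2(\mathbb{R}^n)=\mathcal{C}_V(\mathbb{R}^n)\times\mathcal{C}_V(\mathbb{R}^n)$. Sums are Minkowski sums ($\mathcal{C}_V(\mathbb{R}^n)$ is closed under Minkowski addition). Pairs $(A,B),(C,D)\in\mathcal{C}_V^2(\mathbb{R}^n)$ are equivalent if $A+D=B+C$; this is an equivalence relation and $[A,B]$ denotes the class (a set of pairs) of $(A,B)$. Pairs are ordered by $(A_1,B_1)\prec(A_2,B_2)$ iff $A_1\subset A_2$ and $B_1\subset B_2$. A pair $(A,B)$ is $0$-minimal if it is a minimal element (with respect to $\prec$) of $\{(C,D)\in[A,B]\mid 0\in D\}$ (in particular $0\in B$). A translate of $(A,B)$ is a pair $(A-x,B-x)$ with $x\in\mathbb{R}^n$. A pair $(A,B)$ (or its class) has the property of translation if any two $0$-minimal pairs in $[A,B]$ are translates of each other. A pair $(A,B)\in\mathcal{C}_V^2(\mathbb{R}^n)$ is reduced if $[A,B]=\{(A+M,B+M)\mid M\in\mathcal{C}_V(\mathbb{R}^n)\}$. *)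

theory Defs
  imports "HOL-Analysis.Analysis"
begin

text \<open>
  Throughout, \<open>A + B\<close> on sets is the Minkowski sum from \<open>HOL-Library.Set_Algebras\<close>.
  The cone \<open>V\<close> is an explicit parameter of every notion that depends on the ambient family
  of sets with recession cone \<open>V\<close>.
\<close>

definition recession_cone :: "'a::euclidean_space set \<Rightarrow> 'a set"
  where "recession_cone A = {x. (\<lambda>a. x + a) ` A \<subseteq> A}"

definition convex_family :: "'a::euclidean_space set \<Rightarrow> 'a set set"
  where "convex_family V =
    {A. A \<noteq> {} \<and> closed A \<and> convex A \<and> recession_cone A = V}"

definition pair_class ::
    "'a::euclidean_space set \<Rightarrow> 'a set \<times> 'a set \<Rightarrow> ('a set \<times> 'a set) set"
  where "pair_class V P =
    {Q \<in> convex_family V \<times> convex_family V. fst P + snd Q = snd P + fst Q}"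

definition pair_le :: "'a set \<times> 'a set \<Rightarrow> 'a set \<times> 'a set \<Rightarrow> bool"
  where "pair_le P Q \<longleftrightarrow> fst P \<subseteq> fst Q \<and> snd P \<subseteq> snd Q"

definition translate_pair ::
    "'a::euclidean_space \<Rightarrow> 'a set \<times> 'a set \<Rightarrow> 'a set \<times> 'a set"
  where "translate_pair x P = ((\<lambda>a. a - x) ` fst P, (\<lambda>b. b - x) ` snd P)"

text \<open>
  The membership conjunct says that \<open>P\<close> itself lies in the set in which it is minimal; in
  particular both components of \<open>P\<close> are in \<open>convex_family V\<close> and \<open>0 \<in> snd P\<close>.
\<close>

definition zero_minimal :: "'a::euclidean_space set \<Rightarrow> 'a set \<times> 'a set \<Rightarrow> bool"
  where "zero_minimal V P \<longleftrightarrow>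
    P \<in> {Q \<in> pair_class V P. 0 \<in> snd Q} \<and>
    (\<forall>R \<in> {Q \<in> pair_class V P. 0 \<in> snd Q}. pair_le R P \<longrightarrow> R = P)"

definition translation_property :: "'a::euclidean_space set \<Rightarrow> 'a set \<times> 'a set \<Rightarrow> bool"
  where "translation_property V P \<longleftrightarrow>
    (\<forall>Q \<in> pair_class V P. \<forall>R \<in> pair_class V P.
      zero_minimal V Q \<and> zero_minimal V R \<longrightarrow> (\<exists>x. R = translate_pair x Q))"

definition reduced_pair :: "'a::euclidean_space set \<Rightarrow> 'a set \<times> 'a set \<Rightarrow> bool"
  where "reduced_pair V P \<longleftrightarrow>
    P \<in> convex_family V \<times> convex_family V \<and>
    pair_class V P = {(fst P + M, snd P + M) | M. M \<in> convex_family V}"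

end

theory Submission
  imports Defs
begin

text \<open>
  Let \<open>(E, F)\<close> be any pair equivalent to \<open>(C, D)\<close>, and let \<open>f \<in> F\<close>.  The translate
  \<open>(E - f, F - f)\<close> is again equivalent to \<open>(C, D)\<close> and its second component contains \<open>0\<close>, so
  some \<open>0\<close>-minimal pair lies below it (lemma \<open>zero_minimal_below\<close>).  By the property of
  translation that pair is \<open>(C - x, D - x)\<close>, with \<open>x \<in> D\<close> because its second component
  contains \<open>0\<close>.  Hence \<open>y = f - x\<close> satisfies \<open>C + y \<subseteq> E\<close>, \<open>D + y \<subseteq> F\<close> and \<open>f \<in> D + y\<close>.
  Let \<open>M\<close> be the set of all \<open>y\<close> with \<open>C + y \<subseteq> E\<close> and \<open>D + y \<subseteq> F\<close>.  As \<open>f\<close> was arbitrary,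
  \<open>F = D + M\<close>; and then \<open>D + E = C + F = D + (C + M)\<close> gives \<open>E = C + M\<close> by cancellation.

  Two facts about sets with the same recession cone \<open>V\<close> carry this: cancellation
  (\<open>convex_family_cancel_le\<close>), and the possibility of passing to the limit along chains of
  equivalent pairs, which Zorn's lemma needs in order to produce minimal pairs
  (\<open>add_Inter_chain\<close>).  The sets are unbounded, so neither follows from compactness of the
  summands.  The substitute is \<open>bounded_complement_section\<close>.  If \<open>a + b\<close> stays bounded while
  \<open>a\<close> and \<open>b\<close> run off to infinity, then their limiting directions are opposite and both lie
  in \<open>V\<close>, that is, they lie in the lineality space of \<open>V\<close>.  Shifting that part of \<open>a\<close>
  to \<open>b\<close> changes neither set nor the sum, so \<open>a\<close> may be taken orthogonal to the lineality
  space, and then it has to stay bounded.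
\<close>

section \<open>Recession directions\<close>

lemma convex_familyD:
  assumes "A \<in> convex_family V"
  shows "A \<noteq> {}" "closed A" "convex A" "recession_cone A = V"
  using assms by (auto simp: convex_family_def)

lemma convex_family_add_mem:
  assumes "A \<in> convex_family V" "v \<in> V" "a \<in> A"
  shows "v + a \<in> A"
  using assms by (auto simp: convex_family_def recession_cone_def)

text \<open>
  For \<open>x \<in> A\<close> the convex combinations \<open>(1 - t n) x + t n a n\<close> lie in \<open>A\<close> and tend to \<open>x + v\<close>.
\<close>
lemma recession_cone_limit:
  fixes A :: "'a::euclidean_space set"
  assumes A: "closed A" "convex A"
    and a: "\<And>n. a n \<in> A" and t0: "\<And>n. 0 \<le> t n" and t: "t \<longlonglongrightarrow> (0::real)"
    and v: "(\<lambda>n. t n *\<^sub>R a n) \<longlonglongrightarrow> v"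
  shows "v \<in> recession_cone A"
  unfolding recession_cone_def
proof clarify
  fix x assume x: "x \<in> A"
  have "\<forall>\<^sub>F n in sequentially. t n < 1"
    using t by (simp add: order_tendsto_iff)
  then have ev: "\<forall>\<^sub>F n in sequentially. (1 - t n) *\<^sub>R x + t n *\<^sub>R a n \<in> A"
    by eventually_elim (use A(2) x a t0 in \<open>auto simp: convex_alt\<close>)
  have "(\<lambda>n. (1 - t n) *\<^sub>R x + t n *\<^sub>R a n) \<longlonglongrightarrow> (1 - 0) *\<^sub>R x + v"
    by (intro tendsto_intros t v)
  then have "(1 - 0) *\<^sub>R x + v \<in> A"
    using Lim_in_closed_set[OF A(1) ev] by simp
  then show "v + x \<in> A" by (simp add: add.commute)
qed

text \<open>
  Translations by \<open>z\<close> that keep one point of \<open>A\<close> inside \<open>A\<close> forever already make \<open>z\<close> a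
  recession direction, because \<open>z\<close> is the limit of \<open>(n z + b) / n\<close>.
\<close>
lemma recession_cone_mono:
  fixes A B :: "'a::euclidean_space set"
  assumes "closed A" "convex A" "B \<subseteq> A" "B \<noteq> {}"
  shows "recession_cone B \<subseteq> recession_cone A"
proof
  fix z assume z: "z \<in> recession_cone B"
  obtain b where b: "b \<in> B" using assms(4) by auto
  have in_B: "real n *\<^sub>R z + b \<in> B" for n
  proof (induction n)
    case (Suc n)
    then have "z + (real n *\<^sub>R z + b) \<in> B"
      using z by (auto simp: recession_cone_def)
    then show ?case by (simp add: algebra_simps)
  qed (use b in simp)
  let ?t = "\<lambda>n. inverse (real (Suc n))"
  have "(\<lambda>n. z + ?t n *\<^sub>R b) \<longlonglongrightarrow> z + 0 *\<^sub>R b"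
    by (intro tendsto_intros LIMSEQ_inverse_real_of_nat)
  moreover have "?t n *\<^sub>R (real (Suc n) *\<^sub>R z + b) = z + ?t n *\<^sub>R b" for n
    by (simp add: scaleR_add_right del: of_nat_Suc)
  ultimately have "(\<lambda>n. ?t n *\<^sub>R (real (Suc n) *\<^sub>R z + b)) \<longlonglongrightarrow> z"
    by (simp del: of_nat_Suc)
  then show "z \<in> recession_cone A"
    using assms in_B[of "Suc n" for n]
    by (intro recession_cone_limit[where t = ?t and a = "\<lambda>n. real (Suc n) *\<^sub>R z + b"])
      (auto simp del: of_nat_Suc intro: LIMSEQ_inverse_real_of_nat)
qed

section \<open>Compactness modulo the lineality space\<close>

definition lineality_space :: "'a::euclidean_space set \<Rightarrow> 'a set"
  where "lineality_space V = {v \<in> V. - v \<in> V}"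

lemma subspace_lineality_space:
  assumes "convex_cone V"
  shows "subspace (lineality_space V)"
proof -
  have "c *\<^sub>R x \<in> lineality_space V" if "x \<in> lineality_space V" for c x
  proof (cases "c \<ge> 0")
    case True
    then show ?thesis
      using that assms convex_cone_scaleR[OF assms, of c] scaleR_minus_right[of c x]
      by (metis (mono_tags, lifting) lineality_space_def mem_Collect_eq)
  next
    case False
    then have "(- c) *\<^sub>R x \<in> V" "(- c) *\<^sub>R (- x) \<in> V"
      using that convex_cone_scaleR[OF assms, of "- c"] unfolding lineality_space_def
      by (simp_all del: scaleR_minus_left scaleR_minus_right)
    moreover have "(- c) *\<^sub>R x = - (c *\<^sub>R x)" "(- c) *\<^sub>R (- x) = c *\<^sub>R x"
      by simp_all
    ultimately show ?thesis unfolding lineality_space_def by (metis (mono_tags) mem_Collect_eq)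
  qed
  then show ?thesis
    using assms by (auto simp: subspace_def lineality_space_def convex_cone_iff)
qed

text \<open>
  This replaces compactness for the unbounded members of the family.  An unbounded sequence of
  such \<open>x\<close>, with partners \<open>y\<close>, has after normalisation a limiting direction \<open>l\<close>; the
  direction of \<open>y\<close> is then \<open>- l\<close>, as \<open>x + y\<close> is bounded.  So \<open>l\<close> is a unit vector that
  belongs both to the lineality space and to its orthogonal complement.
\<close>
lemma bounded_complement_section:
  fixes A B K :: "'a::euclidean_space set"
  assumes A: "A \<in> convex_family V" and B: "B \<in> convex_family V" and K: "bounded K"
  shows "bounded {x \<in> A \<inter> (lineality_space V)\<^sup>\<bottom>. \<exists>y\<in>B. x + y \<in> K}" (is "bounded ?S")
proof (rule ccontr)
  assume unbounded: "\<not> bounded ?S"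
  define S where "S = ?S"
  have "\<not> bounded S" using unbounded unfolding S_def .
  then have "\<forall>n. \<exists>x. x \<in> S \<and> norm x > real (Suc n)"
    unfolding bounded_iff by (meson not_le)
  then obtain x where xS: "\<And>n. x n \<in> S" and big: "\<And>n. norm (x n) > real (Suc n)"
    by metis
  have x: "x n \<in> A" "x n \<in> (lineality_space V)\<^sup>\<bottom>" "\<exists>y. y \<in> B \<and> x n + y \<in> K" for n
    using xS[of n] by (auto simp: S_def)
  obtain y where y: "\<And>n. y n \<in> B" "\<And>n. x n + y n \<in> K"
    using x(3) by metis
  define t where "t n = inverse (norm (x n))" for n
  define u where "u n = t n *\<^sub>R x n" for n
  have pos: "norm (x n) > 0" for n
    using big[of n] by (meson less_trans of_nat_0_less_iff zero_less_Suc)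
  have t0: "0 \<le> t n" for n by (simp add: t_def)
  have "norm (t n) \<le> inverse (real (Suc n))" for n
    using big[of n] t0[of n] by (simp add: t_def le_imp_inverse_le del: of_nat_Suc)
  then have t: "t \<longlonglongrightarrow> 0"
    by (intro Lim_null_comparison[OF _ LIMSEQ_inverse_real_of_nat]) auto
  have "u n \<in> sphere 0 1" for n
    using pos[of n] by (simp add: u_def t_def)
  then obtain l r where l: "l \<in> sphere 0 1" and r: "strict_mono r" and lim: "(u \<circ> r) \<longlonglongrightarrow> l"
    using compact_sphere[of 0 1, unfolded compact_eq_seq_compact_metric seq_compact_def]
    by metis
  have tr: "(\<lambda>n. t (r n)) \<longlonglongrightarrow> 0"
    using LIMSEQ_subseq_LIMSEQ[OF t r] by (simp add: o_def)
  have lim_x: "(\<lambda>n. t (r n) *\<^sub>R x (r n)) \<longlonglongrightarrow> l"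
    using lim by (simp add: u_def o_def)
  have "l \<in> recession_cone A"
    using recession_cone_limit[OF convex_familyD(2,3)[OF A] x(1) t0 tr lim_x] .
  then have lV: "l \<in> V" using convex_familyD[OF A] by simp
  obtain M where M: "\<And>z. z \<in> K \<Longrightarrow> norm z \<le> M"
    using K by (auto simp: bounded_iff)
  have xy: "(\<lambda>n. t (r n) *\<^sub>R (x (r n) + y (r n))) \<longlonglongrightarrow> 0"
  proof (rule Lim_null_comparison)
    show "\<forall>\<^sub>F n in sequentially. norm (t (r n) *\<^sub>R (x (r n) + y (r n))) \<le> t (r n) * M"
      using M y t0 by (intro always_eventually allI) (simp add: mult_left_mono)
    show "(\<lambda>n. t (r n) * M) \<longlonglongrightarrow> 0"
      using tendsto_mult_left_zero[OF tr] .
  qed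
  from tendsto_diff[OF xy lim_x]
  have lim_y: "(\<lambda>n. t (r n) *\<^sub>R y (r n)) \<longlonglongrightarrow> - l"
    by (simp add: scaleR_add_right)
  have "- l \<in> recession_cone B"
    using recession_cone_limit[OF convex_familyD(2,3)[OF B] y(1) t0 tr lim_y] .
  then have "l \<in> lineality_space V"
    using lV convex_familyD[OF B] by (simp add: lineality_space_def)
  moreover have "l \<in> (lineality_space V)\<^sup>\<bottom>"
  proof (rule closed_sequentially[OF closed_subspace[OF subspace_orthogonal_comp] _ lim_x])
    show "t (r n) *\<^sub>R x (r n) \<in> (lineality_space V)\<^sup>\<bottom>" for n
      by (rule subspace_scale[OF subspace_orthogonal_comp x(2)])
  qed
  ultimately have "l = 0"
    by (auto simp: orthogonal_comp_def orthogonal_def)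
  then show False using l by simp
qed

text \<open>
  The lineality component of a point of \<open>A\<close> can be moved into the other summand, since both
  sets are invariant under the lineality space.
\<close>
lemma complement_section_add:
  fixes A B :: "'a::euclidean_space set"
  assumes V: "convex_cone V" and A: "A \<in> convex_family V" and B: "B \<in> convex_family V"
  shows "(A \<inter> (lineality_space V)\<^sup>\<bottom>) + B = A + B"
proof
  show "A + B \<subseteq> (A \<inter> (lineality_space V)\<^sup>\<bottom>) + B"
  proof
    fix x assume "x \<in> A + B"
    then obtain a b where ab: "x = a + b" "a \<in> A" "b \<in> B" by (auto elim: set_plus_elim)
    obtain y z where yz: "a = z + y" "y \<in> lineality_space V" "z \<in> (lineality_space V)\<^sup>\<bottom>"
      using subspace_sum_orthogonal_comp[OF subspace_lineality_space[OF V]]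
      by (metis UNIV_I add.commute set_plus_elim)
    have "- y + a \<in> A" "y + b \<in> B"
      using yz(2) ab(2,3) convex_family_add_mem[OF A, of "- y"] convex_family_add_mem[OF B, of y]
      unfolding lineality_space_def by blast+
    then show "x \<in> (A \<inter> (lineality_space V)\<^sup>\<bottom>) + B"
      using set_plus_intro[of z "A \<inter> (lineality_space V)\<^sup>\<bottom>" "y + b" B] ab yz
      by (simp add: algebra_simps)
  qed
qed (rule set_plus_mono2[OF Int_lower1 order_refl])

section \<open>The semigroup of closed convex sets with a given recession cone\<close>

text \<open>
  Radstrom's telescoping argument.  Starting from \<open>b0 \<in> B\<close>, repeated use of the inclusion
  gives \<open>a + b0 = c1 + b1\<close>, \<open>a + b1 = c2 + b2\<close> and so on; adding up, \<open>a + b0 / n = c + bn / n\<close>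
  with \<open>c \<in> C\<close> an average of the \<open>ci\<close>.  For bounded \<open>B\<close> the error \<open>(bn - b0) / n\<close> tends
  to \<open>0\<close>.  In general one chooses the \<open>bi\<close> orthogonal to the lineality space; then \<open>bn / n\<close> is
  bounded, a subsequence of it tends to some \<open>v \<in> V\<close>, and closedness of \<open>C\<close> gives
  \<open>a - v \<in> C\<close>, whence \<open>a \<in> C + V = C\<close>.
\<close>
lemma convex_family_cancel_le:
  fixes A B C :: "'a::euclidean_space set"
  assumes V: "convex_cone V" and B: "B \<in> convex_family V" and C: "C \<in> convex_family V"
    and sub: "A + B \<subseteq> C + B"
  shows "A \<subseteq> C"
proof
  fix a assume a: "a \<in> A"
  let ?X = "B \<inter> (lineality_space V)\<^sup>\<bottom>"
  have CX: "C + B = C + ?X" using complement_section_add[OF V B C] by (simp add: add.commute)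
  have step: "\<exists>c\<in>C. \<exists>b'\<in>?X. a + b = c + b'" if "b \<in> B" for b
    using set_plus_intro[OF a that] sub unfolding CX by (blast elim: set_plus_elim)
  obtain b0 where b0: "b0 \<in> ?X" using step convex_familyD(1)[OF B] by blast
  have "\<exists>c\<in>C. \<exists>b\<in>?X. real (Suc n) *\<^sub>R a + b0 = real (Suc n) *\<^sub>R c + b" for n
  proof (induction n)
    case 0
    then show ?case using step[of b0] b0 by simp
  next
    case (Suc n)
    then obtain c b where cb: "c \<in> C" "b \<in> ?X" "real (Suc n) *\<^sub>R a + b0 = real (Suc n) *\<^sub>R c + b"
      by blast
    obtain c' b' where cb': "c' \<in> C" "b' \<in> ?X" "a + b = c' + b'" using step cb by blast
    let ?s = "inverse (real (Suc (Suc n)))"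
    let ?c = "(1 - ?s) *\<^sub>R c + ?s *\<^sub>R c'"
    have "?s \<le> 1" by (simp add: inverse_le_1_iff)
    then have "?c \<in> C"
      using convex_familyD(3)[OF C] cb(1) cb'(1) unfolding convex_alt by auto
    moreover have "real (Suc (Suc n)) *\<^sub>R a + b0 = real (Suc (Suc n)) *\<^sub>R ?c + b'"
    proof -
      have "real (Suc (Suc n)) *\<^sub>R a + b0 = a + (real (Suc n) *\<^sub>R a + b0)"
        by (simp add: algebra_simps scaleR_2)
      also have "\<dots> = a + (real (Suc n) *\<^sub>R c + b)" by (simp only: cb(3))
      also have "\<dots> = real (Suc n) *\<^sub>R c + (a + b)" by (simp only: add.left_commute)
      also have "\<dots> = real (Suc n) *\<^sub>R c + c' + b'" by (simp only: cb'(3) add.assoc)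
      also have "real (Suc n) *\<^sub>R c + c' = real (Suc (Suc n)) *\<^sub>R ?c"
      proof -
        have "real (Suc (Suc n)) * (1 - ?s) = real (Suc n)" "real (Suc (Suc n)) * ?s = 1"
          by (simp_all add: field_simps)
        then show ?thesis by (simp only: scaleR_add_right scaleR_scaleR scaleR_one)
      qed
      finally show ?thesis .
    qed
    ultimately show ?case using cb'(2) by blast
  qed
  then obtain c b where c: "\<And>n. c n \<in> C" and b: "\<And>n. b n \<in> ?X"
    and eq: "\<And>n. real (Suc n) *\<^sub>R a + b0 = real (Suc n) *\<^sub>R c n + b n"
    by metis
  \<comment> \<open>Mixing in \<open>b0\<close> turns \<open>b n / (n + 1)\<close> into a point of \<open>B\<close> whose sum with \<open>c n\<close> does not
      depend on \<open>n\<close>, which is the form needed for boundedness.\<close>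
  define t where "t n = inverse (real (Suc n))" for n
  define q where "q n = (1 - t n) *\<^sub>R b0 + t n *\<^sub>R b n" for n
  have t: "t \<longlonglongrightarrow> 0" unfolding t_def by (rule LIMSEQ_inverse_real_of_nat)
  have t01: "0 \<le> t n" "t n \<le> 1" for n by (auto simp: t_def inverse_le_1_iff)
  have "convex ?X"
    using convex_familyD(3)[OF B] subspace_imp_convex[OF subspace_orthogonal_comp]
    by (intro convex_Int) auto
  then have q: "q n \<in> ?X" for n
    unfolding q_def convex_alt using b0 b t01 by blast
  have cq: "q n + c n = a + b0" for n
  proof -
    have "t n *\<^sub>R (real (Suc n) *\<^sub>R a + b0) = t n *\<^sub>R (real (Suc n) *\<^sub>R c n + b n)"
      by (simp only: eq)
    moreover have "t n * real (Suc n) = 1" by (simp add: t_def del: of_nat_Suc)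
    ultimately have "a + t n *\<^sub>R b0 = c n + t n *\<^sub>R b n"
      by (simp only: scaleR_add_right scaleR_scaleR scaleR_one)
    then show ?thesis by (simp add: q_def algebra_simps)
  qed
  have "bounded (range q)"
    by (rule bounded_subset[OF bounded_complement_section[OF B C bounded_insert[THEN iffD2, OF bounded_empty]]])
      (use q c cq in blast)
  then obtain l r where r: "strict_mono r" and l: "(q \<circ> r) \<longlonglongrightarrow> l"
    using bounded_imp_convergent_subsequence by blast
  have tr: "(\<lambda>n. t (r n)) \<longlonglongrightarrow> 0"
    using LIMSEQ_subseq_LIMSEQ[OF t r] by (simp add: o_def)
  have "(\<lambda>n. q (r n) - (1 - t (r n)) *\<^sub>R b0) \<longlonglongrightarrow> l - (1 - 0) *\<^sub>R b0"
    using l tr by (intro tendsto_intros) (simp_all add: o_def)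
  then have lim: "(\<lambda>n. t (r n) *\<^sub>R b (r n)) \<longlonglongrightarrow> l - b0"
    by (simp add: q_def)
  have "l - b0 \<in> recession_cone B"
    using recession_cone_limit[OF convex_familyD(2,3)[OF B] _ t01(1) tr lim] b by blast
  then have v: "l - b0 \<in> V" using convex_familyD[OF B] by simp
  have "(\<lambda>n. a + b0 - q (r n)) \<longlonglongrightarrow> a + b0 - l"
    using l by (intro tendsto_intros) (simp add: o_def)
  moreover have "a + b0 - q (r n) = c (r n)" for n using cq[of "r n"] by (simp add: algebra_simps)
  ultimately have "(\<lambda>n. c (r n)) \<longlonglongrightarrow> a + b0 - l" by simp
  then have "a + b0 - l \<in> C"
    using closed_sequentially[OF convex_familyD(2)[OF C], of "\<lambda>n. c (r n)"] c by simp
  from convex_family_add_mem[OF C v this] show "a \<in> C" by simp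
qed

lemma convex_family_cancel:
  fixes A B C :: "'a::euclidean_space set"
  assumes "convex_cone V" "A \<in> convex_family V" "B \<in> convex_family V" "C \<in> convex_family V"
    and "A + B = C + B"
  shows "A = C"
proof
  show "A \<subseteq> C" by (rule convex_family_cancel_le[OF assms(1,3,4)]) (simp only: assms(5) order_refl)
  show "C \<subseteq> A" by (rule convex_family_cancel_le[OF assms(1,3,2)]) (simp only: assms(5) order_refl)
qed

text \<open>
  A sum of closed sets need not be closed; here it is, because the first summands of a
  convergent sequence of sums can be chosen bounded.  That the sum has no recession directions
  outside \<open>V\<close> is an instance of cancellation: \<open>z + A + B \<subseteq> A + B\<close> implies \<open>z + A \<subseteq> A\<close>.
\<close>
lemma convex_family_add:
  fixes A B :: "'a::euclidean_space set"
  assumes V: "convex_cone V" and A: "A \<in> convex_family V" and B: "B \<in> convex_family V"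
  shows "A + B \<in> convex_family V"
proof -
  let ?X = "A \<inter> (lineality_space V)\<^sup>\<bottom>"
  have "closed (A + B)"
    unfolding closed_sequential_limits
  proof (intro allI impI, elim conjE)
    fix x l assume x: "\<forall>n. x n \<in> A + B" and lim: "x \<longlonglongrightarrow> l"
    have "\<forall>n. \<exists>a\<in>?X. \<exists>b\<in>B. x n = a + b"
      using x unfolding complement_section_add[OF V A B, symmetric] by (blast elim: set_plus_elim)
    then obtain a b where a: "\<And>n. a n \<in> ?X" and b: "\<And>n. b n \<in> B" and ab: "\<And>n. x n = a n + b n"
      by metis
    have "a n + b n \<in> range x" for n by (metis ab rangeI)
    then have "bounded (range a)"
      by (intro bounded_subset[OF bounded_complement_section[OF A B
              convergent_imp_bounded[OF lim]]])
        (use a b in blast)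
    then obtain a' r where r: "strict_mono r" and a': "(a \<circ> r) \<longlonglongrightarrow> a'"
      using bounded_imp_convergent_subsequence by blast
    have "(\<lambda>n. (x \<circ> r) n - (a \<circ> r) n) \<longlonglongrightarrow> l - a'"
      by (intro tendsto_diff a' LIMSEQ_subseq_LIMSEQ[OF lim r])
    then have "(\<lambda>n. b (r n)) \<longlonglongrightarrow> l - a'" by (simp add: ab)
    then have "l - a' \<in> B" using closed_sequentially[OF convex_familyD(2)[OF B], of "\<lambda>n. b (r n)"] b by simp
    moreover have "a' \<in> A"
      using closed_sequentially[OF convex_familyD(2)[OF A] _ a'] a by simp
    ultimately show "l \<in> A + B" using set_plus_intro[of a' A "l - a'" B] by simp
  qed
  moreover have "recession_cone (A + B) \<subseteq> V"
  proof
    fix z assume "z \<in> recession_cone (A + B)"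
    then have z: "z + x \<in> A + B" if "x \<in> A + B" for x
      using that by (auto simp: recession_cone_def)
    have "(+) z ` A + B \<subseteq> A + B"
    proof
      fix x assume "x \<in> (+) z ` A + B"
      then obtain a b where "x = z + a + b" "a \<in> A" "b \<in> B" by (auto elim: set_plus_elim)
      then show "x \<in> A + B" using z[of "a + b"] by (auto simp: add.assoc)
    qed
    then have "z \<in> recession_cone A"
      using convex_family_cancel_le[OF V B A] by (simp add: recession_cone_def)
    then show "z \<in> V" using convex_familyD[OF A] by simp
  qed
  moreover have "V \<subseteq> recession_cone (A + B)"
  proof
    fix v assume v: "v \<in> V"
    have "v + (a + b) \<in> A + B" if "a \<in> A" "b \<in> B" for a b
      using convex_family_add_mem[OF A v that(1)] that(2) set_plus_intro[of "v + a" A b B]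
      by (simp add: add.assoc)
    then show "v \<in> recession_cone (A + B)"
      by (auto simp: recession_cone_def elim!: set_plus_elim)
  qed
  moreover have "A + B \<noteq> {}" using convex_familyD(1)[OF A] convex_familyD(1)[OF B] by blast
  ultimately show ?thesis
    using convex_set_plus convex_familyD(3)[OF A] convex_familyD(3)[OF B]
    by (auto simp: convex_family_def)
qed

lemma convex_family_translate:
  fixes A :: "'a::euclidean_space set"
  assumes "A \<in> convex_family V"
  shows "A + {z} \<in> convex_family V"
proof -
  have im: "A + {z} = (\<lambda>a. z + a) ` A"
    by (auto simp: set_plus_def add.commute)
  have "recession_cone ((\<lambda>a. z + a) ` A) = recession_cone A"
  proof -
    have "x + (z + a) \<in> (\<lambda>a. z + a) ` A \<longleftrightarrow> x + a \<in> A" for x a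
      by (auto simp: image_iff algebra_simps)
    then show ?thesis unfolding recession_cone_def by (simp add: image_subset_iff)
  qed
  then show ?thesis
    using assms unfolding im convex_family_def
    by (auto intro: closed_translation)
qed

lemma convex_family_Inter:
  fixes \<F> :: "'a::euclidean_space set set"
  assumes fam: "\<F> \<subseteq> convex_family V" and ne: "\<F> \<noteq> {}" "\<Inter>\<F> \<noteq> {}"
  shows "\<Inter>\<F> \<in> convex_family V"
proof -
  obtain F where F: "F \<in> \<F>" using ne by blast
  then have FV: "F \<in> convex_family V" using fam by blast
  have "recession_cone (\<Inter>\<F>) \<subseteq> recession_cone F"
    using convex_familyD[OF FV] F ne by (intro recession_cone_mono) auto
  moreover have "V \<subseteq> recession_cone (\<Inter>\<F>)"
    using convex_family_add_mem fam by (fastforce simp: recession_cone_def)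
  ultimately show ?thesis
    using ne fam convex_familyD(4)[OF FV]
    by (auto simp: convex_family_def intro!: closed_Inter convex_Inter)
qed

text \<open>
  For \<open>x\<close> in every \<open>A + F\<close>, the points \<open>y \<in> F\<close> orthogonal to the lineality space with
  \<open>x - y \<in> A\<close> form a chain of nonempty compact sets as \<open>F\<close> varies, so one \<open>y\<close> serves all \<open>F\<close>.
\<close>
lemma add_Inter_chain:
  fixes A :: "'a::euclidean_space set"
  assumes V: "convex_cone V" and A: "A \<in> convex_family V"
    and fam: "\<F> \<subseteq> convex_family V"
    and chain: "\<And>F G. F \<in> \<F> \<Longrightarrow> G \<in> \<F> \<Longrightarrow> F \<subseteq> G \<or> G \<subseteq> F"
    and ne: "\<F> \<noteq> {}"
  shows "(\<Inter>F\<in>\<F>. A + F) = A + \<Inter>\<F>"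
proof
  show "(\<Inter>F\<in>\<F>. A + F) \<subseteq> A + \<Inter>\<F>"
  proof
    fix x assume x: "x \<in> (\<Inter>F\<in>\<F>. A + F)"
    define S where "S F = F \<inter> (lineality_space V)\<^sup>\<bottom> \<inter> {y. x - y \<in> A}" for F
    have "\<Inter>(S ` \<F>) \<noteq> {}"
    proof (rule compact_chain)
      fix T assume "T \<in> S ` \<F>"
      then obtain F where F: "F \<in> \<F>" "T = S F" by blast
      then have FV: "F \<in> convex_family V" using fam by blast
      have "closed ((\<lambda>y. x - y) -` A)"
        by (intro closed_vimage convex_familyD(2)[OF A] continuous_intros)
      then have "closed T"
        unfolding F(2) S_def
        using convex_familyD(2)[OF FV] closed_subspace[OF subspace_orthogonal_comp]
        by (auto simp: vimage_def intro!: closed_Int)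
      moreover have "bounded T"
        by (rule bounded_subset[OF bounded_complement_section[OF FV A, of "{x}"]])
          (auto simp: F(2) S_def intro!: bexI[of _ "x - _"])
      ultimately show "compact T" by (simp add: compact_eq_bounded_closed)
    next
      have "S F \<noteq> {}" if F: "F \<in> \<F>" for F
      proof -
        have "x \<in> (F \<inter> (lineality_space V)\<^sup>\<bottom>) + A"
          using x F fam complement_section_add[OF V _ A] by (auto simp: add.commute)
        then obtain y a where "x = y + a" "y \<in> F \<inter> (lineality_space V)\<^sup>\<bottom>" "a \<in> A"
          by (rule set_plus_elim)
        then have "y \<in> S F" by (simp add: S_def)
        then show ?thesis by blast
      qed
      then show "{} \<notin> S ` \<F>" by blast
    next
      fix T U assume "T \<in> S ` \<F> \<and> U \<in> S ` \<F>"
      then show "T \<subseteq> U \<or> U \<subseteq> T" using chain unfolding S_def by blast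
    qed
    then obtain y where "\<And>F. F \<in> \<F> \<Longrightarrow> y \<in> S F" by blast
    then have "y \<in> \<Inter>\<F>" "x - y \<in> A" using ne by (auto simp: S_def)
    then show "x \<in> A + \<Inter>\<F>" using set_plus_intro[of "x - y" A y] by simp
  qed
qed (auto elim!: set_plus_elim)

section \<open>Minimal pairs\<close>

lemma mem_pair_class_iff:
  "(E, F) \<in> pair_class V (A, B) \<longleftrightarrow>
    E \<in> convex_family V \<and> F \<in> convex_family V \<and> A + F = B + E"
  by (simp add: pair_class_def)

text \<open>Transitivity of the equivalence of pairs; this is where it depends on cancellation.\<close>
lemma pair_class_eqI:
  assumes V: "convex_cone V" and A: "A \<in> convex_family V" and B: "B \<in> convex_family V"
    and CD: "(C, D) \<in> pair_class V (A, B)"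
  shows "pair_class V (C, D) = pair_class V (A, B)"
proof -
  have C: "C \<in> convex_family V" and D: "D \<in> convex_family V" and eq: "A + D = B + C"
    using CD by (auto simp: mem_pair_class_iff)
  have "C + F = D + E \<longleftrightarrow> A + F = B + E" if E: "E \<in> convex_family V" and F: "F \<in> convex_family V" for E F
  proof
    assume "C + F = D + E"
    then have "(A + F) + D = (B + E) + D"
      using eq by (metis add.assoc add.commute)
    then show "A + F = B + E"
      using convex_family_cancel[OF V _ D] convex_family_add[OF V] A B E F by blast
  next
    assume "A + F = B + E"
    then have "(C + F) + B = (D + E) + B"
      using eq by (metis add.assoc add.commute)
    then show "C + F = D + E"
      using convex_family_cancel[OF V _ B] convex_family_add[OF V] C D E F by blast
  qed
  then have "(E, F) \<in> pair_class V (C, D) \<longleftrightarrow> (E, F) \<in> pair_class V (A, B)" for E F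
    unfolding mem_pair_class_iff by blast
  then show ?thesis by (simp add: set_eq_iff)
qed

text \<open>
  Zorn's lemma, with the componentwise intersection as lower bound of a chain of pairs.  The
  second intersection contains \<open>0\<close>.  The equation \<open>A + F = B + E\<close> passes to the intersections
  by \<open>add_Inter_chain\<close>, and it also shows that the first intersection is nonempty.
\<close>
lemma zero_minimal_below:
  assumes V: "convex_cone V" and A: "A \<in> convex_family V" and B: "B \<in> convex_family V"
    and Q: "Q \<in> pair_class V (A, B)" "0 \<in> snd Q"
  shows "\<exists>R \<in> pair_class V (A, B). zero_minimal V R \<and> pair_le R Q"
proof -
  let ?S = "{R \<in> pair_class V (A, B). 0 \<in> snd R \<and> pair_le R Q}"
  let ?ge = "\<lambda>R R'. pair_le R' R"
  have "\<exists>m\<in>?S. \<forall>R\<in>?S. ?ge m R \<longrightarrow> R = m"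
  proof (rule predicate_Zorn)
    show "partial_order_on ?S (relation_of ?ge ?S)"
      by (rule partial_order_on_relation_ofI) (auto simp: pair_le_def prod_eq_iff)
  next
    fix \<C> assume "\<C> \<in> Chains (relation_of ?ge ?S)"
    then have sub: "\<C> \<subseteq> ?S"
      and ch: "\<And>R R'. R \<in> \<C> \<Longrightarrow> R' \<in> \<C> \<Longrightarrow> pair_le R R' \<or> pair_le R' R"
      by (auto simp: Chains_def relation_of_def)
    show "\<exists>m\<in>?S. \<forall>R\<in>\<C>. ?ge R m"
    proof (cases "\<C> = {}")
      case True
      then show ?thesis using Q by (intro bexI[of _ Q]) (auto simp: pair_le_def)
    next
      case False
      let ?E = "\<Inter>(fst ` \<C>)" and ?F = "\<Inter>(snd ` \<C>)"
      have fams: "fst ` \<C> \<subseteq> convex_family V" "snd ` \<C> \<subseteq> convex_family V"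
        using sub by (auto simp: pair_class_def)
      have fst_chain: "G \<subseteq> H \<or> H \<subseteq> G" if "G \<in> fst ` \<C>" "H \<in> fst ` \<C>" for G H
        using that by (elim imageE) (metis ch pair_le_def)
      have snd_chain: "G \<subseteq> H \<or> H \<subseteq> G" if "G \<in> snd ` \<C>" "H \<in> snd ` \<C>" for G H
        using that by (elim imageE) (metis ch pair_le_def)
      have "(\<Inter>G\<in>snd ` \<C>. A + G) = A + ?F"
        by (rule add_Inter_chain[OF V A fams(2) snd_chain]) (use False in auto)
      moreover have "(\<Inter>G\<in>fst ` \<C>. B + G) = B + ?E"
        by (rule add_Inter_chain[OF V B fams(1) fst_chain]) (use False in auto)
      moreover have "(\<Inter>G\<in>snd ` \<C>. A + G) = (\<Inter>G\<in>fst ` \<C>. B + G)"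
      proof -
        have "A + snd R = B + fst R" if "R \<in> \<C>" for R
          using subsetD[OF sub that] by (simp add: pair_class_def)
        then show ?thesis unfolding image_image by (rule INF_cong[OF refl])
      qed
      ultimately have eq: "A + ?F = B + ?E" by simp
      have zero: "0 \<in> ?F" using sub by blast
      obtain a where "a \<in> A" using convex_familyD(1)[OF A] by blast
      from set_plus_intro[OF this zero] have "a \<in> B + ?E" unfolding eq by simp
      then have "?E \<noteq> {}" by (rule set_plus_elim) blast
      then have E: "?E \<in> convex_family V"
        by (intro convex_family_Inter[OF fams(1)]) (use False in simp_all)
      have F: "?F \<in> convex_family V"
        by (rule convex_family_Inter[OF fams(2)]) (use False zero in blast)+
      have below: "pair_le (?E, ?F) R" if "R \<in> \<C>" for R
        unfolding pair_le_def fst_conv snd_conv using that by blast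
      obtain R where "R \<in> \<C>" using False by blast
      then have "pair_le R Q" using sub by blast
      then have "pair_le (?E, ?F) Q"
        using below[OF \<open>R \<in> \<C>\<close>] unfolding pair_le_def by (meson order_trans)
      moreover have "(?E, ?F) \<in> pair_class V (A, B)"
        using E F eq unfolding mem_pair_class_iff by blast
      ultimately have "(?E, ?F) \<in> ?S" using zero unfolding mem_Collect_eq snd_conv by blast
      then show ?thesis by (rule bexI[rotated]) (use below in blast)
    qed
  qed
  then obtain R where R: "R \<in> ?S" and min: "\<And>R'. R' \<in> ?S \<Longrightarrow> pair_le R' R \<Longrightarrow> R' = R"
    by blast
  have cls: "pair_class V R = pair_class V (A, B)"
    using pair_class_eqI[OF V A B, of "fst R" "snd R"] R by simp
  then have "zero_minimal V R"
  proof -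
    have le: "pair_le R Q" and R': "R \<in> pair_class V (A, B)" "0 \<in> snd R" using R by auto
    have "R' = R" if "R' \<in> pair_class V (A, B)" "0 \<in> snd R'" "pair_le R' R" for R'
    proof -
      have "pair_le R' Q" using le that(3) unfolding pair_le_def by (meson order_trans)
      then show ?thesis using min that by blast
    qed
    then show ?thesis using R' unfolding zero_minimal_def cls by blast
  qed
  then show ?thesis using R by blast
qed

theorem proposition3p2:
  fixes V A B C D :: "(real ^ 'n) set"
  assumes "closed V" and "convex_cone V"
    and "(A, B) \<in> convex_family V \<times> convex_family V"
    and "translation_property V (A, B)"
    and "(C, D) \<in> pair_class V (A, B)"
    and "zero_minimal V (C, D)"
  shows "reduced_pair V (C, D)"
proof -
  note V = assms(2)
  have A: "A \<in> convex_family V" and B: "B \<in> convex_family V" using assms(3) by auto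
  have C: "C \<in> convex_family V" and D: "D \<in> convex_family V"
    using assms(5) by (auto simp: mem_pair_class_iff)
  note cls = pair_class_eqI[OF V A B assms(5)]
  have "\<exists>M\<in>convex_family V. E = C + M \<and> F = D + M" if EF: "(E, F) \<in> pair_class V (C, D)" for E F
  proof -
    have E: "E \<in> convex_family V" and F: "F \<in> convex_family V" and eq: "C + F = D + E"
      using EF by (auto simp: mem_pair_class_iff)
    \<comment> \<open>the largest candidate for the common summand\<close>
    define M where "M = {y. C + {y} \<subseteq> E \<and> D + {y} \<subseteq> F}"
    have cover: "\<exists>y\<in>M. f \<in> D + {y}" if f: "f \<in> F" for f
    proof -
      let ?Q = "(E + {- f}, F + {- f})"
      have "C + (F + {- f}) = D + (E + {- f})" by (simp add: eq add.assoc[symmetric])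
      then have "?Q \<in> pair_class V (C, D)"
        using convex_family_translate[OF E] convex_family_translate[OF F]
        by (simp add: mem_pair_class_iff)
      moreover have "0 \<in> snd ?Q" using set_plus_intro[OF f, of "- f" "{- f}"] by simp
      ultimately obtain R where R: "R \<in> pair_class V (C, D)" "zero_minimal V R" "pair_le R ?Q"
        using zero_minimal_below[OF V C D] by blast
      obtain x where x: "R = translate_pair x (C, D)"
        using assms(4-6) R unfolding translation_property_def cls by blast
      have "0 \<in> snd R" using R(2) by (simp add: zero_minimal_def)
      then have xD: "x \<in> D" by (auto simp: x translate_pair_def)
      have shift: "G + {f - x} \<subseteq> H" if "(\<lambda>g. g - x) ` G \<subseteq> H + {- f}" for G H :: "(real ^ 'n) set"
      proof
        fix z assume "z \<in> G + {f - x}"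
        then obtain g where g: "g \<in> G" "z = g + (f - x)" by (auto elim: set_plus_elim)
        then have "g - x \<in> H + {- f}" using that by blast
        then obtain h where "h \<in> H" "g - x = h + - f" by (auto elim: set_plus_elim)
        then show "z \<in> H" using g by (simp add: algebra_simps)
      qed
      have "f - x \<in> M"
        using R(3) shift by (auto simp: M_def x translate_pair_def pair_le_def)
      moreover have "f \<in> D + {f - x}"
        using set_plus_intro[OF xD, of "f - x" "{f - x}"] by simp
      ultimately show ?thesis by blast
    qed
    have memM: "y \<in> M \<longleftrightarrow> (\<forall>c\<in>C. c + y \<in> E) \<and> (\<forall>d\<in>D. d + y \<in> F)" for y
      unfolding M_def by (auto simp: set_plus_def)
    have FDM: "F = D + M"
    proof
      show "F \<subseteq> D + M" using cover unfolding set_plus_def by blast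
      show "D + M \<subseteq> F" by (auto simp: memM elim!: set_plus_elim)
    qed
    have M: "M \<in> convex_family V"
    proof -
      have Meq: "M = (\<Inter>c\<in>C. (\<lambda>e. - c + e) ` E) \<inter> (\<Inter>d\<in>D. (\<lambda>e. - d + e) ` F)"
        unfolding set_eq_iff memM by (force simp: image_iff algebra_simps)
      have "M \<noteq> {}" using cover convex_familyD(1)[OF F] by blast
      moreover have "closed M"
        unfolding Meq using convex_familyD(2)[OF E] convex_familyD(2)[OF F]
        by (intro closed_Int closed_INT ballI closed_translation)
      moreover have "convex M"
        unfolding Meq using convex_familyD(3)[OF E] convex_familyD(3)[OF F]
        by (intro convex_Int convex_INT convex_translation)
      moreover have "recession_cone M = V"
      proof
        show "V \<subseteq> recession_cone M"
          using convex_family_add_mem[OF E] convex_family_add_mem[OF F]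
          by (fastforce simp: recession_cone_def memM add.left_commute)
        show "recession_cone M \<subseteq> V"
        proof
          fix z assume z: "z \<in> recession_cone M"
          have "z + (d + m) \<in> F" if "d \<in> D" "m \<in> M" for d m
          proof -
            have "z + m \<in> M" using z that by (auto simp: recession_cone_def)
            then show ?thesis using that by (simp add: memM add.left_commute)
          qed
          then have "z \<in> recession_cone F"
            unfolding recession_cone_def by (auto simp: FDM elim!: set_plus_elim)
          then show "z \<in> V" using convex_familyD[OF F] by simp
        qed
      qed
      ultimately show ?thesis by (simp add: convex_family_def)
    qed
    have "E + D = (C + M) + D"
      using eq by (simp add: FDM ac_simps)
    then have "E = C + M"
      using convex_family_cancel[OF V E D convex_family_add[OF V C M]] by simp
    then show ?thesis using FDM M by blast
  qed
  moreover have "(C + M, D + M) \<in> pair_class V (C, D)" if "M \<in> convex_family V" for M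
    using that convex_family_add[OF V] C D by (simp add: mem_pair_class_iff add.left_commute)
  ultimately have "pair_class V (C, D) = {(C + M, D + M) | M. M \<in> convex_family V}"
    by fast
  then show ?thesis using C D by (simp add: reduced_pair_def)
qed

end
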